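(* Let $O\subseteq\mathbb{R}^d$ be Borel-measurable with Borel $\sigma$-algebra $\mathcal{O}$, let $\mathcal{P}$ be a family of probability measures on $(O,\mathcal{O})$, let $(\Omega,\mathcal{A},\mathbb{P})$ be a probability space, $Y:\Omega\to O$ a random variable, and $\mathcal{F}\subseteq\mathcal{A}$ a sub-$\sigma$-algebra. Let $\mathbb{P}_{Y|\mathcal{F}}$ be a regular version of the conditional distribution of $Y$ given $\mathcal{F}$ such that $\mathbb{P}_{Y|\mathcal{F}}(\omega;\cdot)\in\mathcal{P}$ for all $\omega\in\Omega$. If the functional $T:\mathcal{P}\to\mathbb{R}$ is $\mathcal{A}(\mathcal{P})$-$\mathcal{B}$-measurable, then the map $$T(Y|\mathcal{F}):\Omega\to\mathbb{R},\qquad \omega\mapsto T\big(\mathbb{P}_{Y|\mathcal{F}}(\omega;\cdot)\big),$$ is $\mathcal{F}$-$\mathcal{B}$-measurable.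
   Context: $\mathcal{B}$ denotes the Borel $\sigma$-algebra of $\mathbb{R}$. A Markov kernel from $(\Omega,\mathcal{F})$ to $(O,\mathcal{O})$ is a map $\kappa:\Omega\times\mathcal{O}\to[0,1]$ such that $B\mapsto\kappa(\omega,B)$ is a probability measure on $(O,\mathcal{O})$ for each $\omega\in\Omega$, and $\omega\mapsto\kappa(\omega,B)$ is $\mathcal{F}$-$\mathcal{B}[0,1]$-measurable for each $B\in\mathcal{O}$. A regular version $\mathbb{P}_{Y|\mathcal{F}}$ of the conditional distribution of $Y$ given $\mathcal{F}$ is a Markov kernel from $(\Omega,\mathcal{F})$ to $(O,\mathcal{O})$ with $\mathbb{P}(F\cap\{Y\in B\})=\int_F\mathbb{P}_{Y|\mathcal{F}}(\omega;B)\,\mathrm{d}\mathbb{P}(\omega)$ for all $F\in\mathcal{F}$, $B\in\mathcal{O}$. Let $\mathcal{Q}$ be the family of all probability measures on $(O,\mathcal{O})$. For $B\in\mathcal{O}$ the evaluation map is $\pi_B:\mathcal{Q}\to[0,1]$, $\pi_B(\mathrm{P})=\mathrm{P}(B)$. $\mathcal{A}(\mathcal{Q})$ is the smallest $\sigma$-algebra on $\mathcal{Q}$ making all $\pi_B$, $B\in\mathcal{O}$, measurable with respect to the Borel $\sigma$-algebra $\mathcal{B}[0,1]$ of $[0,1]$. For $\mathcal{P}\subseteq\mathcal{Q}$, $\mathcal{A}(\mathcal{P})=\{\mathcal{P}\cap C\mid C\in\mathcal{A}(\mathcal{Q})\}$ is the trace $\sigma$-algebra on $\mathcal{P}$ (equivalently,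 the $\sigma$-algebra generated by the restrictions of the maps $\pi_B$ to $\mathcal{P}$). *)

theory Defs
  imports "HOL-Probability.Probability"
begin

text \<open>
  A kernel is encoded as a measure-valued map: \<open>\<kappa>(\<omega>, B)\<close> is \<open>measure (\<kappa> \<omega>) B\<close>.
  Nothing is assumed about \<open>\<kappa> \<omega>\<close> for \<open>\<omega>\<close> outside \<open>space F\<close>.
\<close>

definition markov_kernel :: "'w measure \<Rightarrow> 'a measure \<Rightarrow> ('w \<Rightarrow> 'a measure) \<Rightarrow> bool" where
  "markov_kernel F N \<kappa> \<longleftrightarrow>
     (\<forall>\<omega>\<in>space F. prob_space (\<kappa> \<omega>) \<and> sets (\<kappa> \<omega>) = sets N) \<and>
     (\<forall>B\<in>sets N. (\<lambda>\<omega>. measure (\<kappa> \<omega>) B) \<in> F \<rightarrow>\<^sub>M restrict_space borel {0..1})"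

text \<open>
  Only the space and the sets of \<open>F\<close> matter here; the integral is taken with respect to \<open>M\<close>.
\<close>

definition regular_cond_distr ::
  "'w measure \<Rightarrow> 'w measure \<Rightarrow> 'a measure \<Rightarrow> ('w \<Rightarrow> 'a) \<Rightarrow> ('w \<Rightarrow> 'a measure) \<Rightarrow> bool" where
  "regular_cond_distr M F N Y \<kappa> \<longleftrightarrow>
     markov_kernel F N \<kappa> \<and>
     (\<forall>A\<in>sets F. \<forall>B\<in>sets N.
        measure M (A \<inter> (Y -` B \<inter> space M)) = (LINT \<omega>:A|M. measure (\<kappa> \<omega>) B))"

text \<open>
  The set of all probability measures on \<open>N\<close> with the \<open>\<sigma>\<close>-algebra generated by the evaluation
  maps is the library's \<open>prob_algebra N\<close>. The library obtains it as the trace of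
  \<open>subprob_algebra N\<close>, generated by evaluations with values in \<open>ennreal\<close>; the next two lemmas
  confirm that it is the \<open>\<sigma>\<close>-algebra generated by the \<open>[0,1]\<close>-valued evaluation maps.
\<close>

lemma space_prob_algebra_iff:
  "P \<in> space (prob_algebra N) \<longleftrightarrow> prob_space P \<and> sets P = sets N"
  by (auto simp: space_prob_algebra)

lemma sets_prob_algebra_eq_sigma_sets:
  fixes N :: "'a measure"
  defines "Q \<equiv> space (prob_algebra N)"
  shows "sets (prob_algebra N) =
    sigma_sets Q {(\<lambda>P. measure P B) -` A \<inter> Q | A B.
                    B \<in> sets N \<and> A \<in> sets (restrict_space borel {0..1::real})}"
    (is "_ = sigma_sets Q ?G")
proof
  have eval: "(\<lambda>P. measure P B) \<in> prob_algebra N \<rightarrow>\<^sub>M restrict_space borel {0..1}"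
    if "B \<in> sets N" for B
  proof (rule measurable_restrict_space2)
    show "(\<lambda>P. measure P B) \<in> space (prob_algebra N) \<rightarrow> {0..1}"
      by (auto simp: space_prob_algebra prob_space.prob_le_1)
    show "(\<lambda>P. measure P B) \<in> borel_measurable (prob_algebra N)"
      using that by (auto simp: prob_algebra_def intro!: measurable_restrict_space1)
  qed
  have "?G \<subseteq> sets (prob_algebra N)"
    using measurable_sets[OF eval] by (auto simp: Q_def)
  then show "sigma_sets Q ?G \<subseteq> sets (prob_algebra N)"
    unfolding Q_def by (rule sets.sigma_sets_subset)
next
  have G: "?G \<subseteq> Pow Q" by auto
  note sp = space_measure_of[OF G]
  have Q: "P \<in> Q \<longleftrightarrow> prob_space P \<and> sets P = sets N" for P
    unfolding Q_def by (rule space_prob_algebra_iff)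
  have "(\<lambda>P. P) \<in> sigma Q ?G \<rightarrow>\<^sub>M prob_algebra N"
  proof (rule measurable_prob_algebraI)
    show "prob_space P" if "P \<in> space (sigma Q ?G)" for P
      using that unfolding sp Q by blast
    show "(\<lambda>P. P) \<in> sigma Q ?G \<rightarrow>\<^sub>M subprob_algebra N"
    proof (rule measurable_subprob_algebra)
      fix P assume "P \<in> space (sigma Q ?G)"
      then have P: "prob_space P" "sets P = sets N"
        unfolding sp Q by blast+
      then show "subprob_space P" "sets P = sets N"
        by (auto intro: prob_space_imp_subprob_space)
    next
      fix B assume B: "B \<in> sets N"
      have m: "(\<lambda>P. measure P B) \<in> sigma Q ?G \<rightarrow>\<^sub>M restrict_space borel {0..1}"
      proof (rule measurableI)
        fix P assume "P \<in> space (sigma Q ?G)"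
        then show "measure P B \<in> space (restrict_space borel {0..1})"
          unfolding sp Q
          by (auto simp: prob_space.prob_le_1)
      next
        fix A :: "real set" assume "A \<in> sets (restrict_space borel {0..1})"
        then show "(\<lambda>P. measure P B) -` A \<inter> space (sigma Q ?G) \<in> sets (sigma Q ?G)"
          unfolding space_measure_of[OF G] sets_measure_of[OF G]
          using B by (intro sigma_sets.Basic) blast
      qed
      have "(\<lambda>P. measure P B) \<in> borel_measurable (sigma Q ?G)"
        using m by (simp only: measurable_restrict_space2_iff)
      then have "(\<lambda>P. ennreal (measure P B)) \<in> borel_measurable (sigma Q ?G)"
        by (rule measurable_compose[OF _ measurable_ennreal])
      moreover have "emeasure P B = ennreal (measure P B)" if "P \<in> space (sigma Q ?G)" for P
      proof -
        have "prob_space P"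
          using that unfolding sp Q by blast
        then interpret prob_space P .
        show ?thesis by (rule emeasure_eq_measure)
      qed
      ultimately show "(\<lambda>P. emeasure P B) \<in> borel_measurable (sigma Q ?G)"
        by (subst measurable_cong)
    qed
  qed
  note id = this
  show "sets (prob_algebra N) \<subseteq> sigma_sets Q ?G"
  proof
    fix C assume C: "C \<in> sets (prob_algebra N)"
    have "(\<lambda>P. P) -` C \<inter> space (sigma Q ?G) \<in> sets (sigma Q ?G)"
      by (rule measurable_sets[OF id C])
    moreover have "C \<subseteq> Q"
      using C unfolding Q_def by (rule sets.sets_into_space)
    ultimately show "C \<in> sigma_sets Q ?G"
      by (simp only: space_measure_of[OF G] sets_measure_of[OF G] vimage_ident Int_absorb2)
  qed
qed

end

theory Submission
  imports Defs
begin

text \<open>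
  The conclusion is a composition: \<open>\<omega> \<mapsto> T (\<kappa> \<omega>)\<close> is \<open>T\<close> after \<open>\<kappa>\<close>, so it suffices that \<open>\<kappa>\<close> is
  measurable from \<open>F\<close> into \<open>\<P>\<close> with the trace \<open>\<sigma>\<close>-algebra. The \<open>\<sigma>\<close>-algebra on the probability
  measures is generated by the evaluations at the measurable sets, and each of these evaluations
  composed with \<open>\<kappa>\<close> is measurable by the definition of a Markov kernel. That is the content of
  \<open>markov_kernel_imp_measurable_prob_algebra\<close>; since \<open>\<kappa>\<close> takes all its values in \<open>\<P>\<close>, the
  restriction to the trace is immediate.
\<close>

text \<open>
  A map into \<open>prob_algebra N\<close> is measurable as soon as its composition with every generating
  evaluation is. These evaluations are \<open>ennreal\<close>-valued, so the real-valued measurability in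
  the kernel definition is transported along the embedding \<open>ennreal\<close>, which loses nothing because
  the measures are finite.
\<close>

lemma markov_kernel_imp_measurable_prob_algebra:
  assumes "markov_kernel F N \<kappa>"
  shows "\<kappa> \<in> F \<rightarrow>\<^sub>M prob_algebra N"
proof (rule measurable_prob_algebraI)
  have prob: "prob_space (\<kappa> \<omega>)" and sets: "sets (\<kappa> \<omega>) = sets N" if "\<omega> \<in> space F" for \<omega>
    using assms that by (auto simp: markov_kernel_def)
  show "prob_space (\<kappa> \<omega>)" if "\<omega> \<in> space F" for \<omega>
    using prob[OF that] .
  show "\<kappa> \<in> F \<rightarrow>\<^sub>M subprob_algebra N"
  proof (rule measurable_subprob_algebra)
    show "subprob_space (\<kappa> \<omega>)" if "\<omega> \<in> space F" for \<omega>
      using prob[OF that] by (rule prob_space_imp_subprob_space)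
    show "sets (\<kappa> \<omega>) = sets N" if "\<omega> \<in> space F" for \<omega>
      using sets[OF that] .
    fix B assume "B \<in> sets N"
    then have "(\<lambda>\<omega>. measure (\<kappa> \<omega>) B) \<in> borel_measurable F"
      using assms by (simp add: markov_kernel_def measurable_restrict_space2_iff)
    then have "(\<lambda>\<omega>. ennreal (measure (\<kappa> \<omega>) B)) \<in> borel_measurable F"
      by (rule measurable_compose[OF _ measurable_ennreal])
    moreover have "emeasure (\<kappa> \<omega>) B = ennreal (measure (\<kappa> \<omega>) B)" if "\<omega> \<in> space F" for \<omega>
    proof -
      interpret prob_space "\<kappa> \<omega>" using that by (rule prob)
      show ?thesis by (rule emeasure_eq_measure)
    qed
    ultimately show "(\<lambda>\<omega>. emeasure (\<kappa> \<omega>) B) \<in> borel_measurable F"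
      by (subst measurable_cong)
  qed
qed

theorem lemma3p2:
  fixes Obs :: "(real ^ 'd) set"
    and \<P> :: "(real ^ 'd) measure set"
    and M F :: "'w measure"
    and Y :: "'w \<Rightarrow> real ^ 'd"
    and \<kappa> :: "'w \<Rightarrow> (real ^ 'd) measure"
    and T :: "(real ^ 'd) measure \<Rightarrow> real"
  assumes "Obs \<in> sets borel"
    and "\<P> \<subseteq> space (prob_algebra (restrict_space borel Obs))"
    and "prob_space M"
    and "Y \<in> M \<rightarrow>\<^sub>M restrict_space borel Obs"
    and "subalgebra M F"
    and "regular_cond_distr M F (restrict_space borel Obs) Y \<kappa>"
    and "\<And>\<omega>. \<omega> \<in> space M \<Longrightarrow> \<kappa> \<omega> \<in> \<P>"
    and "T \<in> borel_measurable (restrict_space (prob_algebra (restrict_space borel Obs)) \<P>)"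
  shows "(\<lambda>\<omega>. T (\<kappa> \<omega>)) \<in> borel_measurable F"
proof (rule measurable_compose[OF _ assms(8)])
  have "\<kappa> \<in> F \<rightarrow>\<^sub>M prob_algebra (restrict_space borel Obs)"
    using assms(6) by (intro markov_kernel_imp_measurable_prob_algebra)
      (simp add: regular_cond_distr_def)
  moreover have "\<kappa> \<in> space F \<rightarrow> \<P>"
    using assms(5,7) by (auto simp: subalgebra_def)
  ultimately show "\<kappa> \<in> F \<rightarrow>\<^sub>M restrict_space (prob_algebra (restrict_space borel Obs)) \<P>"
    by (intro measurable_restrict_space2)
qed

end
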